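(* Every circulant directed graph code over $\mathrm{GF}(4)$ and every bordered circulant directed graph code over $\mathrm{GF}(4)$ is isodual.
   Context: $\mathrm{GF}(4)=\{0,1,\omega,\omega^2\}$ with $\omega^2=\omega+1$; conjugation is $\overline{x}=x^2$ and $\mathrm{Tr}(x)=x+\overline{x}\in\mathrm{GF}(2)$. An additive code of length $n$ is an additive subgroup of $\mathrm{GF}(4)^n$; a generator matrix is a matrix whose rows span the code additively. An $n\times n$ matrix is circulant if its $i$th row is the first row cyclically shifted $i-1$ times to the right. A circulant directed graph code of length $n$ is the additive code generated by the rows of $\Gamma+\omega I$, where $\Gamma$ is an $n\times n$ circulant $\{0,1\}$-matrix with zero diagonal and $I$ is the identity. A bordered circulant directed graph code of length $n+1$ is the additive code generated by the rows of the $(n+1)\times(n+1)$ matrix $$\begin{pmatrix}\omega & 1 & \cdots & 1\\ 1 & & & \\ \vdots & & C & \\ 1 & & & \end{pmatrix},$$ where $C=\Gamma+\omega I$ is the generator matrix of a circulant directed graph code of length $n$ as just described. Two additive codes of length $n$ are equivalent if one is mapped onto the other by a permutation of coordinates, followed by multiplication of individual coordinates by nonzero elements of $\mathrm{GF}(4)$, followed by conjugation of some (possibly none) of the coordinates. The dual of $\mathcal{C}$ is $\mathcal{C}^\perp=\{\boldsymbol{u}\in\mathrm{GF}(4)^n \mid \sum_{i}\mathrm{Tr}(u_i\overline{c_i})=0 \text{ for all } \boldsymbol{c}\in\mathcal{C}\}$, and $\mathcal{C}$ is isodual if $\mathcal{C}$ is equivalent to $\mathcal{C}^\perp$. *)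

theory Defs
  imports
    "HOL-Library.Z2"
    "HOL-Combinatorics.Permutations"
    "HOL-Algebra.Generated_Groups"
    "Jordan_Normal_Form.Matrix"
begin

section \<open>The field with four elements\<close>

text \<open>The element \<open>GF4 a b\<close> stands for \<open>a + b * \<omega>\<close>, where \<open>\<omega>^2 = \<omega> + 1\<close>.\<close>

datatype gf4 = GF4 (gf4_re: bit) (gf4_om: bit)

instantiation gf4 :: field
begin

definition zero_gf4 :: gf4 where "0 = GF4 0 0"
definition one_gf4 :: gf4 where "1 = GF4 1 0"
definition plus_gf4 :: "gf4 \<Rightarrow> gf4 \<Rightarrow> gf4" where
  "x + y = GF4 (gf4_re x + gf4_re y) (gf4_om x + gf4_om y)"
definition uminus_gf4 :: "gf4 \<Rightarrow> gf4" where "- x = (x :: gf4)"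
definition minus_gf4 :: "gf4 \<Rightarrow> gf4 \<Rightarrow> gf4" where "x - y = x + (y :: gf4)"
definition times_gf4 :: "gf4 \<Rightarrow> gf4 \<Rightarrow> gf4" where
  "x * y = GF4 (gf4_re x * gf4_re y + gf4_om x * gf4_om y)
     (gf4_re x * gf4_om y + gf4_om x * gf4_re y + gf4_om x * gf4_om y)"
text \<open>Nonzero elements have order dividing three, so the inverse is the square.\<close>
definition inverse_gf4 :: "gf4 \<Rightarrow> gf4" where "inverse x = x * (x :: gf4)"
definition divide_gf4 :: "gf4 \<Rightarrow> gf4 \<Rightarrow> gf4" where "x div y = x * inverse (y :: gf4)"

lemmas gf4_defs = zero_gf4_def one_gf4_def plus_gf4_def uminus_gf4_def minus_gf4_def
  times_gf4_def inverse_gf4_def divide_gf4_def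

instance
proof
  fix a b c :: gf4
  obtain a0 a1 where a: "a = GF4 a0 a1" by (cases a)
  obtain b0 b1 where b: "b = GF4 b0 b1" by (cases b)
  obtain c0 c1 where c: "c = GF4 c0 c1" by (cases c)
  show "a * b * c = a * (b * c)" "a * b = b * a" "1 * a = a"
    "a + b + c = a + (b + c)" "a + b = b + a" "0 + a = a" "- a + a = 0" "a - b = a + - b"
    "(a + b) * c = a * c + b * c" "(0::gf4) \<noteq> 1" "a div b = a * inverse b" "inverse (0::gf4) = 0"
    by (cases a0; cases a1; cases b0; cases b1; cases c0; cases c1;
        simp add: a b c gf4_defs)+
  show "a \<noteq> 0 \<Longrightarrow> inverse a * a = 1"
    by (cases a0; cases a1; simp add: a gf4_defs)
qed

end

definition \<omega> :: gf4 where "\<omega> = GF4 0 1"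

lemma omega_square: "\<omega>^2 = \<omega> + 1"
  by (simp add: \<omega>_def gf4_defs power2_eq_square)

lemma UNIV_gf4: "(UNIV :: gf4 set) = {0, 1, \<omega>, \<omega>^2}"
proof -
  have "x \<in> {0, 1, \<omega>, \<omega>^2}" for x :: gf4
  proof (cases x)
    case (GF4 a b)
    then show ?thesis
      by (cases a; cases b; simp add: \<omega>_def gf4_defs power2_eq_square)
  qed
  then show ?thesis by blast
qed

lemma card_gf4: "card (UNIV :: gf4 set) = 4"
  unfolding UNIV_gf4 by (simp add: \<omega>_def gf4_defs power2_eq_square)

definition gf4_conj :: "gf4 \<Rightarrow> gf4" where
  "gf4_conj x = x^2"

text \<open>The trace takes values in the prime field \<open>{0, 1}\<close>, regarded as a subset of \<^typ>\<open>gf4\<close>.\<close>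

definition gf4_Tr :: "gf4 \<Rightarrow> gf4" where
  "gf4_Tr x = x + gf4_conj x"

section \<open>Additive codes\<close>

definition additive_code :: "nat \<Rightarrow> gf4 vec set \<Rightarrow> bool" where
  "additive_code n C \<longleftrightarrow> subgroup C (monoid_vec TYPE(gf4) n)"

definition generated_code :: "gf4 mat \<Rightarrow> gf4 vec set" where
  "generated_code M = generate (monoid_vec TYPE(gf4) (dim_col M)) (set (rows M))"

definition dual_code :: "nat \<Rightarrow> gf4 vec set \<Rightarrow> gf4 vec set" where
  "dual_code n C =
     {u \<in> carrier_vec n. \<forall>c\<in>C. (\<Sum>i<n. gf4_Tr (u $ i * gf4_conj (c $ i))) = 0}"

definition permute_coords :: "(nat \<Rightarrow> nat) \<Rightarrow> gf4 vec \<Rightarrow> gf4 vec" where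
  "permute_coords p v = vec (dim_vec v) (\<lambda>i. v $ p i)"

definition scale_coords :: "(nat \<Rightarrow> gf4) \<Rightarrow> gf4 vec \<Rightarrow> gf4 vec" where
  "scale_coords a v = vec (dim_vec v) (\<lambda>i. a i * v $ i)"

definition conj_coords :: "nat set \<Rightarrow> gf4 vec \<Rightarrow> gf4 vec" where
  "conj_coords S v = vec (dim_vec v) (\<lambda>i. if i \<in> S then gf4_conj (v $ i) else v $ i)"

definition equivalent_codes :: "nat \<Rightarrow> gf4 vec set \<Rightarrow> gf4 vec set \<Rightarrow> bool" where
  "equivalent_codes n C D \<longleftrightarrow> additive_code n C \<and> additive_code n D \<and>
     (\<exists>p a S. p permutes {..<n} \<and> (\<forall>i<n. a i \<noteq> 0) \<and> S \<subseteq> {..<n} \<and>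
        (conj_coords S \<circ> scale_coords a \<circ> permute_coords p) ` C = D)"

definition isodual :: "nat \<Rightarrow> gf4 vec set \<Rightarrow> bool" where
  "isodual n C \<longleftrightarrow> equivalent_codes n C (dual_code n C)"

section \<open>Circulant and bordered circulant directed graph codes\<close>

definition shift_right :: "'a vec \<Rightarrow> 'a vec" where
  "shift_right v = vec (dim_vec v) (\<lambda>j. if j = 0 then v $ (dim_vec v - 1) else v $ (j - 1))"

text \<open>Rows are indexed from 0, so row \<open>i\<close> is the first row shifted \<open>i\<close> times.\<close>

definition circulant_mat :: "'a mat \<Rightarrow> bool" where
  "circulant_mat M \<longleftrightarrow>
     square_mat M \<and> (\<forall>i < dim_row M. row M i = (shift_right ^^ i) (row M 0))"

definition circulant_directed_graph_generator :: "nat \<Rightarrow> gf4 mat \<Rightarrow> bool" where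
  "circulant_directed_graph_generator n M \<longleftrightarrow>
     (\<exists>\<Gamma> \<in> carrier_mat n n. circulant_mat \<Gamma> \<and> elements_mat \<Gamma> \<subseteq> {0, 1} \<and>
        (\<forall>i<n. \<Gamma> $$ (i, i) = 0) \<and> M = \<Gamma> + \<omega> \<cdot>\<^sub>m 1\<^sub>m n)"

definition circulant_directed_graph_code :: "nat \<Rightarrow> gf4 vec set \<Rightarrow> bool" where
  "circulant_directed_graph_code n C \<longleftrightarrow>
     (\<exists>M. circulant_directed_graph_generator n M \<and> C = generated_code M)"

text \<open>The parameter \<open>n\<close> is the size of the circulant block; the code has length \<open>n + 1\<close>.\<close>

definition bordered_circulant_directed_graph_code :: "nat \<Rightarrow> gf4 vec set \<Rightarrow> bool" where
  "bordered_circulant_directed_graph_code n C \<longleftrightarrow>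
     (\<exists>M. circulant_directed_graph_generator n M \<and>
        C = generated_code
              (four_block_mat (mat 1 1 (\<lambda>_. \<omega>)) (mat 1 n (\<lambda>_. 1)) (mat n 1 (\<lambda>_. 1)) M))"

end

theory Submission
  imports Defs
begin

text \<open>Writing vectors as \<open>a + \<omega> b\<close> with binary \<open>a\<close>, \<open>b\<close>, the code generated by \<open>\<Gamma> + \<omega> I\<close> is
  \<open>{b \<Gamma> + \<omega> b}\<close>. The trace form of \<open>a + \<omega> b\<close> and \<open>c + \<omega> d\<close> is \<open>a \<cdot> d + b \<cdot> c\<close>, so the dual code is
  \<open>{b \<Gamma>\<^sup>T + \<omega> b}\<close>, the code of the transpose of \<open>\<Gamma>\<close>. A circulant matrix is carried to its transpose
  by reversing the index set modulo \<open>n\<close>; fixing the border index in addition handles the bordered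
  case. Hence a permutation of coordinates maps the code onto its dual.\<close>

text \<open>By default the simplifier turns addition and multiplication of bits into XOR and AND.
  Removing these rules keeps the ring form, to which distributivity and \<open>sum.distrib\<close>
  apply.\<close>

declare add_bit_eq_xor [simp del] mult_bit_eq_and [simp del]

section \<open>Arithmetic in the field with four elements\<close>

lemma bit_add_self [simp]: "a + a = (0 :: bit)"
  by (cases a) simp_all

lemma gf4_components [simp]:
  "gf4_re 0 = 0" "gf4_om 0 = 0" "gf4_re 1 = 1" "gf4_om 1 = 0" "gf4_re \<omega> = 0" "gf4_om \<omega> = 1"
  "gf4_re (x + y) = gf4_re x + gf4_re y" "gf4_om (x + y) = gf4_om x + gf4_om y"
  by (simp_all add: gf4_defs \<omega>_def)

lemma gf4_add_self [simp]: "x + x = (0 :: gf4)"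
  by (simp add: zero_gf4_def plus_gf4_def)

lemma vec_gf4_add_self: "v \<in> carrier_vec n \<Longrightarrow> v + v = (0\<^sub>v n :: gf4 vec)"
  by (intro eq_vecI) auto

lemma gf4_Tr_mult_conj:
  "gf4_Tr (x * gf4_conj y) = GF4 (gf4_re x * gf4_om y + gf4_om x * gf4_re y) 0"
proof (cases x; cases y)
  fix a b c d
  assume "x = GF4 a b" "y = GF4 c d"
  then show ?thesis
    by (cases a; cases b; cases c; cases d;
        simp add: gf4_Tr_def gf4_conj_def power2_eq_square gf4_defs)
qed

lemma sum_GF4_re: "(\<Sum>i\<in>A. GF4 (f i) 0) = GF4 (\<Sum>i\<in>A. f i) 0"
  by (induction A rule: infinite_finite_induct) (simp_all add: gf4_defs)

lemma sum_of_bool_eq_mult: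
  fixes f :: "nat \<Rightarrow> bit"
  assumes "i < n"
  shows "(\<Sum>k<n. of_bool (k = i) * f k) = f i" "(\<Sum>k<n. f k * of_bool (k = i)) = f i"
  using assms by (simp_all add: of_bool_def if_distrib[of "\<lambda>x. x * _"] if_distrib[of "(*) _"] cong: if_cong)

section \<open>Directed graph codes and their duals\<close>

text \<open>The \<omega>-components of a codeword record which rows were added, and they force the
  other components. Membership thus becomes a linear condition, from which duals and coordinate
  permutations can be computed without handling spans.\<close>

definition graph_code :: "nat \<Rightarrow> (nat \<Rightarrow> nat \<Rightarrow> bit) \<Rightarrow> gf4 vec set" where
  "graph_code n G =
     {v \<in> carrier_vec n. \<forall>j<n. gf4_re (v $ j) = (\<Sum>i<n. gf4_om (v $ i) * G i j)}"

lemma additive_code_graph_code: "additive_code n (graph_code n G)"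
proof -
  let ?V = "monoid_vec TYPE(gf4) n"
  interpret V: comm_group ?V by (rule comm_group_vec)
  \<comment> \<open>In characteristic two every vector is its own inverse.\<close>
  have inv: "inv\<^bsub>?V\<^esub> v = v" if "v \<in> carrier_vec n" for v
    by (rule V.inv_equality) (use that in \<open>simp_all add: monoid_vec_simps vec_gf4_add_self\<close>)
  have zero: "0\<^sub>v n \<in> graph_code n G"
    by (simp add: graph_code_def)
  show ?thesis
    unfolding additive_code_def
  proof (rule V.subgroupI)
    show "graph_code n G \<subseteq> carrier ?V"
      by (auto simp: graph_code_def monoid_vec_simps)
    show "graph_code n G \<noteq> {}" using zero by auto
    show "inv\<^bsub>?V\<^esub> v \<in> graph_code n G" if "v \<in> graph_code n G" for v
      using that inv by (simp add: graph_code_def)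
    show "v \<otimes>\<^bsub>?V\<^esub> w \<in> graph_code n G" if "v \<in> graph_code n G" "w \<in> graph_code n G" for v w
      using that by (auto simp: graph_code_def monoid_vec_simps distrib_right sum.distrib)
  qed
qed

definition graph_row :: "nat \<Rightarrow> (nat \<Rightarrow> nat \<Rightarrow> bit) \<Rightarrow> nat \<Rightarrow> gf4 vec" where
  "graph_row n G i = vec n (\<lambda>j. GF4 (G i j) (of_bool (j = i)))"

lemma graph_row_carrier [simp]: "graph_row n G i \<in> carrier_vec n"
  by (simp add: graph_row_def)

lemma graph_row_in_graph_code: "i < n \<Longrightarrow> graph_row n G i \<in> graph_code n G"
  by (simp add: graph_code_def graph_row_def sum_of_bool_eq_mult)

text \<open>The inclusion into the span goes by induction on the number of nonzero
  \<omega>-components. If there are none, the defining condition makes the vector zero.\<close>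

lemma graph_code_eq_generate:
  "graph_code n G = generate (monoid_vec TYPE(gf4) n) (graph_row n G ` {..<n})"
    (is "_ = generate ?V ?R")
proof
  interpret V: comm_group ?V by (rule comm_group_vec)
  show "generate ?V ?R \<subseteq> graph_code n G"
    using additive_code_graph_code[of n G] graph_row_in_graph_code
    by (intro V.generate_subgroup_incl) (auto simp: additive_code_def)
  have "v \<in> generate ?V ?R" if "v \<in> graph_code n G" for v
    using that
  proof (induction "card {i. i < n \<and> gf4_om (v $ i) = 1}" arbitrary: v rule: less_induct)
    case less
    have v: "v \<in> carrier_vec n" using less.prems by (simp add: graph_code_def)
    show ?case
    proof (cases "\<exists>i<n. gf4_om (v $ i) = 1")
      case False
      then have om: "gf4_om (v $ i) = 0" if "i < n" for i
        using that by auto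
      have re: "gf4_re (v $ j) = 0" if "j < n" for j
        using less.prems that om by (simp add: graph_code_def)
      have "v $ j = 0" if "j < n" for j
        by (rule gf4.expand) (simp add: re om that)
      with v have "v = 0\<^sub>v n"
        by (intro eq_vecI) simp_all
      then show ?thesis
        using generate.one[of ?V ?R] by (simp add: monoid_vec_simps)
    next
      case True
      then obtain i where i: "i < n" "gf4_om (v $ i) = 1" by blast
      \<comment> \<open>Adding row \<open>i\<close> clears the \<omega>-component at
        \<open>i\<close> and leaves the others alone, so the count drops. Adding the same row once
        more restores \<open>v\<close>.\<close>
      let ?r = "graph_row n G i" and ?w = "v + graph_row n G i"
      have "?w \<in> graph_code n G"
        using subgroup.m_closed[OF additive_code_graph_code[unfolded additive_code_def]
            less.prems graph_row_in_graph_code[OF i(1)]]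
        by (simp add: monoid_vec_simps)
      moreover have om: "gf4_om (?w $ k) = (if k = i then 0 else gf4_om (v $ k))" if "k < n" for k
        using i v that by (simp add: graph_row_def)
      have "{k. k < n \<and> gf4_om (?w $ k) = 1} = {k. k < n \<and> gf4_om (v $ k) = 1} - {i}"
        by (auto simp: om cong: conj_cong split: if_splits)
      then have "{k. k < n \<and> gf4_om (?w $ k) = 1} \<subset> {k. k < n \<and> gf4_om (v $ k) = 1}"
        using i by blast
      then have "card {k. k < n \<and> gf4_om (?w $ k) = 1} < card {k. k < n \<and> gf4_om (v $ k) = 1}"
        by (intro psubset_card_mono) auto
      ultimately have "?w \<in> generate ?V ?R"
        using less.hyps by blast
      moreover have "?r \<in> generate ?V ?R"
        using i by (intro generate.incl) auto
      ultimately have "?w + ?r \<in> generate ?V ?R"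
        using generate.eng[of ?w ?V ?R ?r] by (simp add: monoid_vec_simps)
      moreover have "?w + ?r = v"
        using v by (simp add: assoc_add_vec[of _ n] vec_gf4_add_self[of _ n])
      ultimately show ?thesis by simp
    qed
  qed
  then show "graph_code n G \<subseteq> generate ?V ?R" by blast
qed

lemma generated_code_eq_graph_code:
  assumes M: "M \<in> carrier_mat n n"
    and entries: "\<And>i j. i < n \<Longrightarrow> j < n \<Longrightarrow> M $$ (i, j) = GF4 (G i j) (of_bool (j = i))"
  shows "generated_code M = graph_code n G"
proof -
  have "set (rows M) = row M ` {..<n}"
    using M by (auto simp: rows_def)
  also have "\<dots> = graph_row n G ` {..<n}"
    using assms by (intro image_cong refl eq_vecI) (auto simp: graph_row_def)
  finally show ?thesis
    using M by (simp add: generated_code_def graph_code_eq_generate)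
qed

lemma dual_code_iff_symplectic:
  "u \<in> dual_code n C \<longleftrightarrow> u \<in> carrier_vec n \<and>
     (\<forall>c\<in>C. (\<Sum>i<n. gf4_re (u $ i) * gf4_om (c $ i)) = (\<Sum>i<n. gf4_om (u $ i) * gf4_re (c $ i)))"
proof -
  have eq_iff: "a + b = 0 \<longleftrightarrow> a = b" for a b :: bit
    by (cases a; cases b) simp_all
  show ?thesis
    by (simp add: dual_code_def gf4_Tr_mult_conj sum_GF4_re sum.distrib zero_gf4_def eq_iff)
qed

text \<open>One inclusion tests a dual vector against the rows \<open>graph_row n G k\<close> only;
  the other exchanges the order of a double sum. No dimension count is involved.\<close>

lemma dual_graph_code: "dual_code n (graph_code n G) = graph_code n (\<lambda>i j. G j i)"
proof (intro equalityI subsetI)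
  fix u
  assume u: "u \<in> dual_code n (graph_code n G)"
  have "gf4_re (u $ k) = (\<Sum>i<n. gf4_om (u $ i) * G k i)" if k: "k < n" for k
  proof -
    \<comment> \<open>The \<omega>-part of row \<open>k\<close> is the unit vector at
      \<open>k\<close>, so pairing with it isolates \<open>gf4_re (u $ k)\<close>.\<close>
    have "(\<Sum>i<n. gf4_re (u $ i) * gf4_om (graph_row n G k $ i)) =
        (\<Sum>i<n. gf4_om (u $ i) * gf4_re (graph_row n G k $ i))"
      using u graph_row_in_graph_code[OF k] by (simp add: dual_code_iff_symplectic)
    then show ?thesis
      using k by (simp add: graph_row_def sum_of_bool_eq_mult)
  qed
  then show "u \<in> graph_code n (\<lambda>i j. G j i)"
    using u by (simp add: graph_code_def dual_code_iff_symplectic)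
next
  fix u
  assume u: "u \<in> graph_code n (\<lambda>i j. G j i)"
  have "(\<Sum>i<n. gf4_re (u $ i) * gf4_om (c $ i)) = (\<Sum>i<n. gf4_om (u $ i) * gf4_re (c $ i))"
    if c: "c \<in> graph_code n G" for c
  proof -
    have "(\<Sum>i<n. gf4_re (u $ i) * gf4_om (c $ i)) =
        (\<Sum>i<n. \<Sum>j<n. gf4_om (u $ j) * G i j * gf4_om (c $ i))"
      using u by (simp add: graph_code_def sum_distrib_right)
    also have "\<dots> = (\<Sum>j<n. \<Sum>i<n. gf4_om (u $ j) * G i j * gf4_om (c $ i))"
      by (rule sum.swap)
    also have "\<dots> = (\<Sum>j<n. gf4_om (u $ j) * gf4_re (c $ j))"
      using c by (simp add: graph_code_def sum_distrib_left ac_simps)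
    finally show ?thesis .
  qed
  then show "u \<in> dual_code n (graph_code n G)"
    using u by (simp add: graph_code_def dual_code_iff_symplectic)
qed

text \<open>Permuting coordinates relabels the vertices of the digraph; the defining sum is
  reindexed along \<open>p\<close>.\<close>

lemma permute_coords_graph_code:
  assumes p: "p permutes {..<n}"
    and G: "\<And>i j. i < n \<Longrightarrow> j < n \<Longrightarrow> G (p i) (p j) = H i j"
    and v: "v \<in> graph_code n G"
  shows "permute_coords p v \<in> graph_code n H"
proof -
  have p_less: "p i < n" if "i < n" for i
    using permutes_in_image[OF p, of i] that by simp
  have "gf4_re (v $ p j) = (\<Sum>i<n. gf4_om (v $ p i) * H i j)" if "j < n" for j
  proof -
    have "gf4_re (v $ p j) = (\<Sum>i<n. gf4_om (v $ i) * G i (p j))"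
      using v p_less[OF that] by (simp add: graph_code_def)
    also have "\<dots> = (\<Sum>i<n. gf4_om (v $ p i) * G (p i) (p j))"
      by (subst sum.permute[OF p]) simp
    finally show ?thesis using G that by simp
  qed
  then show ?thesis
    using v by (auto simp: graph_code_def permute_coords_def)
qed

text \<open>The common criterion for both families: an isomorphism from the digraph to its converse
  yields an equivalence of the code with its dual.\<close>

lemma isodual_graph_code:
  assumes p: "p permutes {..<n}"
    and G: "\<And>i j. i < n \<Longrightarrow> j < n \<Longrightarrow> G (p i) (p j) = G j i"
  shows "isodual n (graph_code n G)"
proof -
  let ?H = "\<lambda>i j. G j i"
  \<comment> \<open>The inverse relabelling carries the transpose back to \<open>G\<close>, which
    shows that the image is the whole dual code.\<close>
  define q where "q = inv_into UNIV p"
  have q: "q permutes {..<n}" unfolding q_def by (rule permutes_inv[OF p])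
  have pq: "p (q i) = i" for i unfolding q_def by (rule permutes_inverses(1)[OF p])
  have q_less: "q i < n" if "i < n" for i
    using permutes_in_image[OF q, of i] that by simp
  have G_inv: "?H (q i) (q j) = G i j" if "i < n" "j < n" for i j
    using G[OF q_less[OF that(1)] q_less[OF that(2)]] by (simp add: pq)
  have "permute_coords p ` graph_code n G = graph_code n ?H"
  proof (intro equalityI image_subsetI subsetI)
    fix v assume v: "v \<in> graph_code n G"
    show "permute_coords p v \<in> graph_code n ?H"
      by (rule permute_coords_graph_code[where G = G, OF p _ v]) (rule G)
  next
    fix w assume w: "w \<in> graph_code n ?H"
    have "permute_coords q w \<in> graph_code n G"
      by (rule permute_coords_graph_code[where G = ?H, OF q _ w]) (rule G_inv)
    moreover have "permute_coords p (permute_coords q w) = w"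
      using w permutes_in_image[OF p] permutes_inverses(2)[OF p]
      by (intro eq_vecI) (auto simp: permute_coords_def graph_code_def q_def)
    ultimately show "w \<in> permute_coords p ` graph_code n G"
      by (metis imageI)
  qed
  \<comment> \<open>The equivalence is a pure coordinate permutation: all scalars are 1 and no
    coordinate is conjugated.\<close>
  moreover have "conj_coords {} \<circ> scale_coords (\<lambda>_. 1) \<circ> permute_coords p = permute_coords p"
    by (intro ext eq_vecI) (simp_all add: conj_coords_def scale_coords_def permute_coords_def)
  ultimately have "(conj_coords {} \<circ> scale_coords (\<lambda>_. 1) \<circ> permute_coords p) ` graph_code n G
      = graph_code n ?H"
    by simp
  with p show ?thesis
    unfolding isodual_def equivalent_codes_def dual_graph_code
    by (intro conjI additive_code_graph_code exI[of _ p] exI[of _ "\<lambda>_. 1"] exI[of _ "{}"]) auto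
qed

section \<open>Reversal of a circulant matrix\<close>

lemma dim_shift_right_funpow [simp]: "dim_vec ((shift_right ^^ k) v) = dim_vec v"
  by (induction k) (simp_all add: shift_right_def)

text \<open>Shifting right \<open>k\<close> times means shifting left \<open>k * (n - 1)\<close> times, which avoids truncated
  subtraction of \<open>k\<close>.\<close>

lemma shift_right_funpow_index:
  "j < dim_vec v \<Longrightarrow> (shift_right ^^ k) v $ j = v $ ((j + k * (dim_vec v - 1)) mod dim_vec v)"
proof (induction k arbitrary: j)
  case 0
  then show ?case by simp
next
  case (Suc k)
  let ?n = "dim_vec v"
  \<comment> \<open>The new index is the cyclic predecessor of \<open>j\<close>; for
    \<open>j = 0\<close> it wraps around to the last position.\<close>
  have "(shift_right ^^ Suc k) v $ j = (shift_right ^^ k) v $ ((j + (?n - 1)) mod ?n)"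
    using Suc.prems by (cases j) (simp_all add: shift_right_def)
  also have "\<dots> = v $ (((j + (?n - 1)) mod ?n + k * (?n - 1)) mod ?n)"
    using Suc.prems by (intro Suc.IH) simp
  also have "((j + (?n - 1)) mod ?n + k * (?n - 1)) mod ?n = (j + Suc k * (?n - 1)) mod ?n"
    by (simp add: mod_simps ac_simps)
  finally show ?case .
qed

text \<open>Since \<open>n - 1\<close> acts as -1 modulo \<open>n\<close>, the column index on the
  right is the residue of j - i: a circulant matrix is constant along cyclic diagonals.\<close>

lemma circulant_mat_index:
  assumes M: "M \<in> carrier_mat n n" and circ: "circulant_mat M" and ij: "i < n" "j < n"
  shows "M $$ (i, j) = M $$ (0, (j + i * (n - 1)) mod n)"
proof -
  have "M $$ (i, j) = row M i $ j"
    using M ij by simp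
  also have "\<dots> = (shift_right ^^ i) (row M 0) $ j"
    using circ ij carrier_matD(1)[OF M] unfolding circulant_mat_def by metis
  also have "\<dots> = M $$ (0, (j + i * (n - 1)) mod n)"
    using M ij by (simp add: shift_right_funpow_index)
  finally show ?thesis .
qed

text \<open>Multiplication by \<open>n - 1\<close>, that is negation modulo \<open>n\<close>.\<close>

definition reversal :: "nat \<Rightarrow> nat \<Rightarrow> nat" where
  "reversal n i = (if i < n then i * (n - 1) mod n else i)"

lemma reversal_less: "i < n \<Longrightarrow> reversal n i < n"
  by (simp add: reversal_def)

text \<open>This is (n - 1)^2 = 1 modulo \<open>n\<close>: negating twice changes nothing.\<close>

lemma mult_pred_pred_mod:
  assumes "0 < n"
  shows "(a + i * (n - 1) * (n - 1)) mod n = (a + i) mod (n :: nat)"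
proof -
  obtain m where n: "n = Suc m" using assms by (cases n) auto
  show ?thesis
  proof (cases m)
    \<comment> \<open>Here n = k + 2, so (n - 1)^2 = k n + 1. The remaining case is n = 1, where
      every residue is 0.\<close>
    case (Suc k)
    then have "a + i * (n - 1) * (n - 1) = a + i + i * k * n"
      by (simp add: n algebra_simps)
    then show ?thesis by (metis mod_mult_self1)
  qed (simp add: n)
qed

lemma reversal_reversal: "reversal n (reversal n i) = i"
proof (cases "i < n")
  case True
  then have "reversal n (reversal n i) = (0 + i * (n - 1) * (n - 1)) mod n"
    by (simp add: reversal_def mod_mult_left_eq)
  also have "\<dots> = i"
    using True by (subst mult_pred_pred_mod) simp_all
  finally show ?thesis .
qed (simp add: reversal_def)

lemma involution_permutes:
  assumes "\<And>x. x \<in> A \<Longrightarrow> f x \<in> A" "\<And>x. x \<notin> A \<Longrightarrow> f x = x" "\<And>x. f (f x) = x"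
  shows "f permutes A"
  by (rule bij_imp_permutes) (use assms in \<open>auto intro: bij_betwI[where g = f]\<close>)

lemma reversal_permutes: "reversal n permutes {..<n}"
  by (rule involution_permutes) (simp_all only: lessThan_iff reversal_less reversal_reversal, simp add: reversal_def)

text \<open>Modulo \<open>n\<close>, (-j) - (-i) = i - j, so both entries lie on the same cyclic
  diagonal.\<close>

lemma circulant_mat_reversal:
  assumes M: "M \<in> carrier_mat n n" and circ: "circulant_mat M" and ij: "i < n" "j < n"
  shows "M $$ (reversal n i, reversal n j) = M $$ (j, i)"
proof -
  have "(reversal n j + reversal n i * (n - 1)) mod n = (j * (n - 1) + i * (n - 1) * (n - 1)) mod n"
    using ij by (simp add: reversal_def mod_add_left_eq) (metis mod_add_right_eq mod_mult_left_eq)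
  also have "\<dots> = (i + j * (n - 1)) mod n"
    using ij by (subst mult_pred_pred_mod) (simp_all add: add.commute)
  finally show ?thesis
    using circulant_mat_index[OF M circ reversal_less[OF ij(1)] reversal_less[OF ij(2)]]
      circulant_mat_index[OF M circ ij(2,1)]
    by metis
qed

section \<open>Circulant and bordered circulant codes\<close>

lemma circulant_directed_graph_generator_entries:
  assumes "circulant_directed_graph_generator n M"
  shows "M \<in> carrier_mat n n"
    and "\<exists>G. (\<forall>i<n. \<forall>j<n. M $$ (i, j) = GF4 (G i j) (of_bool (j = i))) \<and>
      (\<forall>i<n. \<forall>j<n. G (reversal n i) (reversal n j) = G j i)"
proof -
  obtain \<Gamma> where \<Gamma>: "\<Gamma> \<in> carrier_mat n n" "circulant_mat \<Gamma>" "elements_mat \<Gamma> \<subseteq> {0, 1}"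
      "\<And>i. i < n \<Longrightarrow> \<Gamma> $$ (i, i) = 0" "M = \<Gamma> + \<omega> \<cdot>\<^sub>m 1\<^sub>m n"
    using assms unfolding circulant_directed_graph_generator_def by blast
  show "M \<in> carrier_mat n n" using \<Gamma> by simp
  have "gf4_re (\<Gamma> $$ (reversal n i, reversal n j)) = gf4_re (\<Gamma> $$ (j, i))"
    if "i < n" "j < n" for i j
    using circulant_mat_reversal[OF \<Gamma>(1,2) that] by simp
  moreover have "M $$ (i, j) = GF4 (gf4_re (\<Gamma> $$ (i, j))) (of_bool (j = i))"
    if ij: "i < n" "j < n" for i j
  proof -
    \<comment> \<open>Entries 0 and 1 have no \<omega>-component, so that of \<open>M\<close> comes
      from the \<omega> I term alone.\<close>
    have "\<Gamma> $$ (i, j) \<in> {0, 1}"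
      using \<Gamma>(1,3) ij by (blast intro: elements_matI)
    then have "gf4_om (\<Gamma> $$ (i, j)) = 0" by auto
    then show ?thesis
      using ij \<Gamma>(1,4,5) by (auto intro!: gf4.expand)
  qed
  ultimately show "\<exists>G. (\<forall>i<n. \<forall>j<n. M $$ (i, j) = GF4 (G i j) (of_bool (j = i))) \<and>
      (\<forall>i<n. \<forall>j<n. G (reversal n i) (reversal n j) = G j i)"
    by (intro exI[of _ "\<lambda>i j. gf4_re (\<Gamma> $$ (i, j))"]) simp
qed

lemma isodual_circulant_directed_graph_code:
  assumes "circulant_directed_graph_code n C"
  shows "isodual n C"
proof -
  obtain M where M: "circulant_directed_graph_generator n M" and C: "C = generated_code M"
    using assms unfolding circulant_directed_graph_code_def by blast
  obtain G where entries: "\<forall>i<n. \<forall>j<n. M $$ (i, j) = GF4 (G i j) (of_bool (j = i))"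
    and G: "\<forall>i<n. \<forall>j<n. G (reversal n i) (reversal n j) = G j i"
    using circulant_directed_graph_generator_entries(2)[OF M] by (elim exE conjE)
  have "C = graph_code n G"
    unfolding C using circulant_directed_graph_generator_entries(1)[OF M]
    by (rule generated_code_eq_graph_code) (simp add: entries)
  moreover have "isodual n (graph_code n G)"
    by (rule isodual_graph_code[OF reversal_permutes]) (simp add: G)
  ultimately show ?thesis by simp
qed

text \<open>The cone over the digraph: a new vertex 0 is joined in both directions to all old
  vertices, whose labels move up by one.\<close>

definition bordered_adjacency :: "(nat \<Rightarrow> nat \<Rightarrow> bit) \<Rightarrow> nat \<Rightarrow> nat \<Rightarrow> bit" where
  "bordered_adjacency G i j =
     (if i = 0 then of_bool (j \<noteq> 0) else if j = 0 then 1 else G (i - 1) (j - 1))"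

definition bordered_reversal :: "nat \<Rightarrow> nat \<Rightarrow> nat" where
  "bordered_reversal n i = (if i = 0 then 0 else Suc (reversal n (i - 1)))"

lemma bordered_reversal_permutes: "bordered_reversal n permutes {..<n + 1}"
proof (rule involution_permutes)
  fix i
  show "bordered_reversal n (bordered_reversal n i) = i"
    by (simp add: bordered_reversal_def reversal_reversal)
  show "bordered_reversal n i \<in> {..<n + 1}" if "i \<in> {..<n + 1}"
    using that reversal_less[of "i - 1" n] by (cases i) (simp_all add: bordered_reversal_def)
  \<comment> \<open>This relies on \<open>reversal n\<close> being the identity from
    \<open>n\<close> onwards.\<close>
  show "bordered_reversal n i = i" if "i \<notin> {..<n + 1}"
    using that by (cases i) (simp_all add: bordered_reversal_def reversal_def)
qed

lemma isodual_bordered_circulant_directed_graph_code: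
  assumes "bordered_circulant_directed_graph_code n C"
  shows "isodual (n + 1) C"
proof -
  obtain M where gen: "circulant_directed_graph_generator n M"
    and C: "C = generated_code
      (four_block_mat (mat 1 1 (\<lambda>_. \<omega>)) (mat 1 n (\<lambda>_. 1)) (mat n 1 (\<lambda>_. 1)) M)"
    using assms unfolding bordered_circulant_directed_graph_code_def by blast
  have M: "M \<in> carrier_mat n n"
    by (rule circulant_directed_graph_generator_entries(1)[OF gen])
  obtain G where entries: "\<forall>i<n. \<forall>j<n. M $$ (i, j) = GF4 (G i j) (of_bool (j = i))"
    and G: "\<forall>i<n. \<forall>j<n. G (reversal n i) (reversal n j) = G j i"
    using circulant_directed_graph_generator_entries(2)[OF gen] by (elim exE conjE)
  have "C = graph_code (n + 1) (bordered_adjacency G)"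
    unfolding C
  proof (rule generated_code_eq_graph_code)
    let ?B = "four_block_mat (mat 1 1 (\<lambda>_. \<omega>)) (mat 1 n (\<lambda>_. 1)) (mat n 1 (\<lambda>_. 1)) M"
    show "?B \<in> carrier_mat (n + 1) (n + 1)"
      by (rule carrier_matI) (simp_all add: carrier_matD[OF M])
    show "?B $$ (i, j) = GF4 (bordered_adjacency G i j) (of_bool (j = i))"
      if ij: "i < n + 1" "j < n + 1" for i j
      using ij carrier_matD[OF M]
      by (cases i; cases j) (simp_all add: bordered_adjacency_def \<omega>_def one_gf4_def entries)
  qed
  moreover have "isodual (n + 1) (graph_code (n + 1) (bordered_adjacency G))"
  proof (rule isodual_graph_code[OF bordered_reversal_permutes])
    \<comment> \<open>The border is symmetric and its vertex 0 is fixed, so only the case of two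
      positive indices uses the property of \<open>G\<close>.\<close>
    show "bordered_adjacency G (bordered_reversal n i) (bordered_reversal n j) =
        bordered_adjacency G j i" if "i < n + 1" "j < n + 1" for i j
      using that by (cases i; cases j) (simp_all add: bordered_adjacency_def bordered_reversal_def G)
  qed
  ultimately show ?thesis by simp
qed

theorem proposition2:
  fixes n :: nat
  shows "(\<forall>C. circulant_directed_graph_code n C \<longrightarrow> isodual n C) \<and>
    (\<forall>C. bordered_circulant_directed_graph_code n C \<longrightarrow> isodual (n + 1) C)"
  using isodual_circulant_directed_graph_code isodual_bordered_circulant_directed_graph_code
  by blast

end
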